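(* In the setting described in the context, assume that $X$ has continuous paths and that $v:[0,T]\times E\to\mathbb R$ is continuous. Suppose there exists a continuous function $\theta:E\to[0,T]$ such that $\theta(x)\in t_*(x)$ for all $x\in E$. Let $(t,x)\in[0,T]\times E$ be such that $t\le\theta(x)$ and set $\tau:=\inf\{s\in[t,T]:s=\theta(X_s)\}$ (with $\inf\emptyset:=T$). Then $\{\tau\in t_*(X_\tau)\}$ is a full $(t,x)$-scenario, and if in addition $\tau\in\mathcal T_{t,T}$, then $$u(t,x)=B_t\,\mathcal E_{t,x}\big[\varrho(t,\tau,X,B)+B_\tau^{-1}f(X_\tau)\big]=v(t,x).$$ Similarly, the result holds true when $(t_*,u,f)$ is replaced by $(t^*,w,h)$: if $\theta:E\to[0,T]$ is continuous with $\theta(x)\in t^*(x)$ for all $x\in E$, $t\le\theta(x)$ and $\tau:=\inf\{s\in[t,T]:s=\theta(X_s)\}$, then $\{\tau\in t^*(X_\tau)\}$ is a full $(t,x)$-scenario, and if in addition $\tau\in\mathcal T_{t,T}$, then $$w(t,x)=B_t\,\mathcal E_{t,x}\big[\varrho(t,\tau,X,B)+B_\tau^{-1}h(X_\tau)\big]=v(t,x).$$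
   Context: Setting. $E$ is a Polish space, $(\Omega,\mathcal F)$ is a measurable space of $E$-valued paths indexed by time, $X$ is the coordinate process $X_t(\omega)=\omega(t)$, and $(\mathcal F_t)_{t\ge0}$ is the filtration generated by $X$. $\mathcal L^0(\Omega)$ denotes the measurable functions $\Omega\to\mathbb R$ and $\mathcal L^\infty(\Omega)$ the bounded ones. $B:[0,\infty)\to(0,\infty)$ is such that $B$ and $1/B$ are bounded on bounded sets, and $B$ is continuous on $[0,T]$. Fix $T\in(0,\infty)$. For $t\in[0,T]$, $\mathcal T_{t,T}$ is a class of $[t,T]$-valued random variables on $\Omega$ (admissible stopping rules), with $\mathcal T_{t,T}\subseteq\mathcal T_{s,T}$ for $s\le t$, and $X_\tau$ is measurable for each $\tau\in\mathcal T_{0,T}$. $\mathcal H$ is a linear subspace of $\mathcal L^0(\Omega)$ with $\mathbf 1_\Omega\in\mathcal H$ and $YZ\in\mathcal H$ for all $Y\in\mathcal H$, $Z\in\mathcal L^\infty(\Omega)$. For each $(t,x)\in[0,T]\times E$ there is given a (possibly nonlinear) map $\mathcal E_{t,x}:\mathcal H\to\mathbb R$. An event $A\in\mathcal F$ is called a full $(t,x)$-scenario if $\mathcal E_{t,x}[Y\mathbf 1_A]=\mathcal E_{t,x}[Y]$ for all $Y\in\mathcal H$. Let $\varrho:[0,T]\times[0,T]\times\Omega\times C([0,T];\mathbb R)\to\mathbb R$ and $g:E\to\mathbb R$ be measurable, with $g(X_T)\in\mathcal H$ and $\varrho(t,\tau,X,B)\in\mathcal H$ for all $t\in[0,T]$,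 $\tau\in\mathcal T_{t,T}$ and for $\tau=T$. Define $$v(t,x):=B_t\,\mathcal E_{t,x}\big[\varrho(t,T,X,B)+B_T^{-1}g(X_T)\big],\quad f(x):=\inf_{0\le t\le T}v(t,x),\quad h(x):=\sup_{0\le t\le T}v(t,x),$$ $$u(t,x):=\sup_{\tau\in\mathcal T_{t,T}}B_t\,\mathcal E_{t,x}\big[\varrho(t,\tau,X,B)+B_\tau^{-1}f(X_\tau)\big],\quad w(t,x):=\inf_{\tau\in\mathcal T_{t,T}}B_t\,\mathcal E_{t,x}\big[\varrho(t,\tau,X,B)+B_\tau^{-1}h(X_\tau)\big].$$ For continuous $v$ define the sets $t_*(x):=\operatorname{arg\,min}\{v(t,x):0\le t\le T\}$ and $t^*(x):=\operatorname{arg\,max}\{v(t,x):0\le t\le T\}$, $x\in E$ (nonempty compact subsets of $[0,T]$). Assumptions, for all $(t,x)\in[0,T]\times E$: (E.I) $\mathcal E_{t,x}[c]=c$ for every constant $c\in\mathbb R$. (E.II) $\mathcal E_{t,x}[Y]\le\mathcal E_{t,x}[Y']$ for all $Y,Y'\in\mathcal H$ with $Y\le Y'$. (E.III) If $Y,Y'\in\mathcal H$, $Y\le Y'$ and $\mathcal E_{t,x}[Y]=\mathcal E_{t,x}[Y']$, then $\{Y=Y'\}$ is a full $(t,x)$-scenario. (E.IV) $\{X_t=x\}$ is a full $(t,x)$-scenario. (E.V) For each $\tau\in\mathcal T_{0,T}$: $v(\tau,X_\tau)$, $\inf_{0\le s\le T}v(s,X_\tau)$ and $\sup_{0\le s\le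 T}v(s,X_\tau)$ belong to $\mathcal H$. (E.VI) (dynamic programming principle) For each $\tau\in\mathcal T_{t,T}$: $v(t,x)=B_t\,\mathcal E_{t,x}\big[\varrho(t,\tau,X,B)+B_\tau^{-1}v(\tau,X_\tau)\big]$. *)

theory Defs
  imports "HOL-Analysis.Analysis"
begin

text \<open>
  Paths are functions of type \<open>real \<Rightarrow> 'e\<close> that are extensional on \<open>{0..}\<close>, and the
  path space \<open>(\<Omega>, \<F>)\<close> is \<open>M :: (real \<Rightarrow> 'e) measure\<close> with \<open>\<Omega> = space M\<close> and
  \<open>\<F> = sets M\<close>; the measure part of \<open>M\<close> is never used. The coordinate process is
  \<open>X\<^sub>t(\<omega>) = \<omega> t\<close>. Random variables are extensional on \<open>space M\<close>, so that they
  correspond one-to-one to functions on \<open>\<Omega>\<close> and every nonlinear functional sees only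
  their values on \<open>\<Omega>\<close>.
\<close>

definition L0 :: "'w measure \<Rightarrow> ('w \<Rightarrow> real) set" where
  "L0 M = borel_measurable M \<inter> extensional (space M)"

definition Linf :: "'w measure \<Rightarrow> ('w \<Rightarrow> real) set" where
  "Linf M = {Z \<in> L0 M. bounded (Z ` space M)}"

definition full_scenario ::
  "'w measure \<Rightarrow> ('w \<Rightarrow> real) set \<Rightarrow> (('w \<Rightarrow> real) \<Rightarrow> real) \<Rightarrow> 'w set \<Rightarrow> bool" where
  "full_scenario M H \<E> A \<longleftrightarrow>
     A \<in> sets M \<and> (\<forall>Y\<in>H. \<E> (\<lambda>\<omega>\<in>space M. Y \<omega> * indicator A \<omega>) = \<E> Y)"

text \<open>The space \<open>C([0,T]; \<real>)\<close> with the Borel sets of its uniform metric; its elements are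
  extensional on \<open>{0..T}\<close>.\<close>

definition borel_C :: "real \<Rightarrow> (real \<Rightarrow> real) measure" where
  "borel_C T =
     (let m = cfunspace (top_of_set {0..T}) (euclidean_metric :: real metric)
      in sigma (mspace m) {U. openin (mtopology_of m) U})"

definition reward_space ::
  "real \<Rightarrow> (real \<Rightarrow> 'e) measure \<Rightarrow> (real \<times> real \<times> (real \<Rightarrow> 'e) \<times> (real \<Rightarrow> real)) measure" where
  "reward_space T M =
     restrict_space borel {0..T} \<Otimes>\<^sub>M (restrict_space borel {0..T} \<Otimes>\<^sub>M (M \<Otimes>\<^sub>M borel_C T))"

text \<open>The random variable \<open>\<rho>(t,\<tau>,X,B) + B\<^sub>\<tau>\<^sup>-\<^sup>1 F(\<tau>,X\<^sub>\<tau>)\<close>. As an element of \<open>C([0,T]; \<real>)\<close>,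
  \<open>B\<close> is restricted to \<open>{0..T}\<close>.\<close>

definition payoff ::
  "(real \<Rightarrow> 'e) measure \<Rightarrow> real \<Rightarrow> (real \<Rightarrow> real)
    \<Rightarrow> (real \<Rightarrow> real \<Rightarrow> (real \<Rightarrow> 'e) \<Rightarrow> (real \<Rightarrow> real) \<Rightarrow> real)
    \<Rightarrow> (real \<Rightarrow> 'e \<Rightarrow> real) \<Rightarrow> real \<Rightarrow> ((real \<Rightarrow> 'e) \<Rightarrow> real) \<Rightarrow> (real \<Rightarrow> 'e) \<Rightarrow> real" where
  "payoff M T B \<rho> F t \<tau> =
     (\<lambda>\<omega>\<in>space M. \<rho> t (\<tau> \<omega>) \<omega> (restrict B {0..T}) + inverse (B (\<tau> \<omega>)) * F (\<tau> \<omega>) (\<omega> (\<tau> \<omega>)))"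

definition argmin_times :: "real \<Rightarrow> (real \<Rightarrow> 'e \<Rightarrow> real) \<Rightarrow> 'e \<Rightarrow> real set" where
  "argmin_times T v x = {t. is_arg_min (\<lambda>s. v s x) (\<lambda>s. s \<in> {0..T}) t}"

definition argmax_times :: "real \<Rightarrow> (real \<Rightarrow> 'e \<Rightarrow> real) \<Rightarrow> 'e \<Rightarrow> real set" where
  "argmax_times T v x = {t. is_arg_max (\<lambda>s. v s x) (\<lambda>s. s \<in> {0..T}) t}"

text \<open>The rule \<open>inf {s \<in> [t,T]. s = \<theta>(X\<^sub>s)}\<close>, with \<open>inf \<emptyset> = T\<close>.\<close>

definition hitting_rule ::
  "(real \<Rightarrow> 'e) measure \<Rightarrow> real \<Rightarrow> ('e \<Rightarrow> real) \<Rightarrow> real \<Rightarrow> (real \<Rightarrow> 'e) \<Rightarrow> real" where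
  "hitting_rule M T \<theta> t =
     (\<lambda>\<omega>\<in>space M. let S = {s \<in> {t..T}. s = \<theta> (\<omega> s)} in if S = {} then T else Inf S)"

end

theory Submission
  imports Defs
begin

text \<open>
  On \<open>{X\<^sub>t = x}\<close> the continuous function \<open>s \<mapsto> s - \<theta>(X\<^sub>s)\<close> is nonpositive at \<open>t\<close> and
  nonnegative at \<open>T\<close>, so it vanishes somewhere and \<open>\<tau> = \<theta>(X\<^sub>\<tau>)\<close>. Hence \<open>{\<tau> \<in> t\<^sub>*(X\<^sub>\<tau>)}\<close> contains
  the full scenario \<open>{X\<^sub>t = x}\<close>. On that event \<open>f(X\<^sub>\<tau>) = v(\<tau>, X\<^sub>\<tau>)\<close>, so the dynamic programming
  principle gives \<open>\<tau>\<close> the value \<open>v(t,x)\<close>; no rule does better, because \<open>f \<le> v(s, \<cdot>)\<close> for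
  every \<open>s\<close>.
\<close>

section \<open>Full scenarios of a nonlinear functional\<close>

text \<open>Fullness of \<open>C\<close> is applied twice, to \<open>Y\<close> times the indicator
  of \<open>A\<close> and to \<open>Y\<close> itself. Since \<open>C\<close> lies in
  \<open>A\<close>, the product of the two indicators is that of \<open>C\<close>, so both values
  equal the value of \<open>Y\<close> times the indicator of \<open>C\<close>. The first application
  requires the truncated variable to stay in \<open>H\<close>, which is where \<open>H_mult\<close>
  enters.\<close>

lemma full_scenario_superset:
  assumes full: "full_scenario M H \<E> C" and "C \<subseteq> A" and A: "A \<in> sets M"
    and H_mult: "\<And>Y Z. Y \<in> H \<Longrightarrow> Z \<in> Linf M \<Longrightarrow> (\<lambda>\<omega>\<in>space M. Y \<omega> * Z \<omega>) \<in> H"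
  shows "full_scenario M H \<E> A"
  unfolding full_scenario_def
proof (intro conjI ballI A)
  fix Y assume Y: "Y \<in> H"
  \<comment> \<open>The indicator is cut off outside \<open>space M\<close> because members of
    \<open>Linf M\<close> are extensional.\<close>
  let ?A = "\<lambda>\<omega>\<in>space M. indicator A \<omega> :: real"
  have "?A \<in> borel_measurable M"
    using A by (simp cong: measurable_cong)
  moreover have "bounded (?A ` space M)"
    by (rule boundedI[of _ 1]) (auto simp: indicator_def)
  ultimately have "?A \<in> Linf M"
    unfolding Linf_def L0_def by simp
  then have "(\<lambda>\<omega>\<in>space M. Y \<omega> * ?A \<omega>) \<in> H"
    using H_mult Y by blast
  also have "(\<lambda>\<omega>\<in>space M. Y \<omega> * ?A \<omega>) = (\<lambda>\<omega>\<in>space M. Y \<omega> * indicator A \<omega>)"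
    by auto
  finally have "\<E> (\<lambda>\<omega>\<in>space M. Y \<omega> * indicator A \<omega>)
      = \<E> (\<lambda>\<omega>\<in>space M. (\<lambda>\<omega>\<in>space M. Y \<omega> * indicator A \<omega>) \<omega> * indicator C \<omega>)"
    using full unfolding full_scenario_def by metis
  also have "(\<lambda>\<omega>\<in>space M. (\<lambda>\<omega>\<in>space M. Y \<omega> * indicator A \<omega>) \<omega> * indicator C \<omega>)
      = (\<lambda>\<omega>\<in>space M. Y \<omega> * indicator C \<omega>)"
    using \<open>C \<subseteq> A\<close> by (auto simp: indicator_def fun_eq_iff)
  also have "\<E> \<dots> = \<E> Y"
    using full Y unfolding full_scenario_def by metis
  finally show "\<E> (\<lambda>\<omega>\<in>space M. Y \<omega> * indicator A \<omega>) = \<E> Y" .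
qed

text \<open>Plays the part of almost sure equality: after truncation to \<open>A\<close> the two
  variables are literally the same function, and fullness removes the truncation on both
  sides.\<close>

lemma full_scenario_cong:
  assumes full: "full_scenario M H \<E> A" and "Y \<in> H" "Z \<in> H"
    and eq: "\<And>\<omega>. \<omega> \<in> A \<Longrightarrow> \<omega> \<in> space M \<Longrightarrow> Y \<omega> = Z \<omega>"
  shows "\<E> Y = \<E> Z"
proof -
  have "(\<lambda>\<omega>\<in>space M. Y \<omega> * indicator A \<omega>) = (\<lambda>\<omega>\<in>space M. Z \<omega> * indicator A \<omega>)"
    using eq by (auto simp: indicator_def fun_eq_iff)
  then show ?thesis
    using full \<open>Y \<in> H\<close> \<open>Z \<in> H\<close> unfolding full_scenario_def by metis
qed

section \<open>Measurability of the event that a path meets the graph of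
  \<open>\<theta>\<close>\<close>

text \<open>With \<open>D\<close> countable this trades an uncountable existential for countable
  operations. A zero is approximated from \<open>D\<close> by continuity; conversely
  \<open>\<bar>\<phi>\<bar>\<close> attains its minimum on the compact \<open>K\<close>, and
  arbitrarily small values on \<open>D\<close> force that minimum to be 0.\<close>

lemma compact_zero_iff_dense:
  fixes \<phi> :: "'a::metric_space \<Rightarrow> real"
  assumes "compact K" "K \<noteq> {}" "continuous_on K \<phi>" "D \<subseteq> K" "K \<subseteq> closure D"
  shows "(\<exists>s\<in>K. \<phi> s = 0) \<longleftrightarrow> (\<forall>n. \<exists>q\<in>D. \<bar>\<phi> q\<bar> < inverse (real (Suc n)))"
proof
  assume "\<exists>s\<in>K. \<phi> s = 0"
  then obtain s where s: "s \<in> K" "\<phi> s = 0" by blast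
  show "\<forall>n. \<exists>q\<in>D. \<bar>\<phi> q\<bar> < inverse (real (Suc n))"
  proof
    fix n
    have "0 < inverse (real (Suc n))" by simp
    then obtain d where d: "0 < d"
      "\<And>q. q \<in> K \<Longrightarrow> dist q s < d \<Longrightarrow> dist (\<phi> q) (\<phi> s) < inverse (real (Suc n))"
      using assms(3) s(1) unfolding continuous_on_iff by meson
    obtain q where "q \<in> D" "dist q s < d"
      using s(1) assms(5) d(1) closure_approachable by blast
    then show "\<exists>q\<in>D. \<bar>\<phi> q\<bar> < inverse (real (Suc n))"
      using d(2)[of q] assms(4) s(2) by (auto simp: dist_real_def)
  qed
next
  assume small: "\<forall>n. \<exists>q\<in>D. \<bar>\<phi> q\<bar> < inverse (real (Suc n))"
  have "continuous_on K (\<lambda>s. \<bar>\<phi> s\<bar>)"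
    using assms(3) by (intro continuous_intros)
  then obtain m where m: "m \<in> K" "\<And>s. s \<in> K \<Longrightarrow> \<bar>\<phi> m\<bar> \<le> \<bar>\<phi> s\<bar>"
    using continuous_attains_inf[OF assms(1,2)] by metis
  have "\<phi> m = 0"
  proof (rule ccontr)
    assume "\<phi> m \<noteq> 0"
    then obtain n where "inverse (real (Suc n)) < \<bar>\<phi> m\<bar>"
      using reals_Archimedean[of "\<bar>\<phi> m\<bar>"] by auto
    moreover obtain q where "q \<in> D" "\<bar>\<phi> q\<bar> < inverse (real (Suc n))"
      using small by blast
    ultimately show False
      using m(2)[of q] assms(4) by auto
  qed
  with m(1) show "\<exists>s\<in>K. \<phi> s = 0" by blast
qed

lemma sets_hits_graph:
  fixes M :: "(real \<Rightarrow> 'e::polish_space) measure"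
  assumes X_measurable: "\<And>s. s \<in> {t..T} \<Longrightarrow> (\<lambda>\<omega>. \<omega> s) \<in> M \<rightarrow>\<^sub>M borel"
    and paths: "\<And>\<omega>. \<omega> \<in> space M \<Longrightarrow> continuous_on {t..T} \<omega>"
    and \<theta>: "continuous_on UNIV \<theta>" and "t \<le> T"
  shows "{\<omega> \<in> space M. \<exists>s\<in>{t..T}. s = \<theta> (\<omega> s)} \<in> sets M"
proof -
  \<comment> \<open>One \<open>D\<close> serves all paths, so the countable quantifiers can be
    pulled out of the set of paths.\<close>
  obtain D where D: "countable D" "D \<subseteq> {t..T}" "{t..T} \<subseteq> closure D"
    using separable by blast
  have hits: "(\<exists>s\<in>{t..T}. s = \<theta> (\<omega> s))
      \<longleftrightarrow> (\<forall>n. \<exists>q\<in>D. \<bar>q - \<theta> (\<omega> q)\<bar> < inverse (real (Suc n)))" if "\<omega> \<in> space M" for \<omega>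
  proof -
    have "continuous_on {t..T} (\<lambda>s. s - \<theta> (\<omega> s))"
      by (intro continuous_intros continuous_on_compose2[OF \<theta> paths[OF that]]) auto
    from compact_zero_iff_dense[OF _ _ this D(2,3)] show ?thesis
      using \<open>t \<le> T\<close> by simp
  qed
  have \<theta>_borel: "\<theta> \<in> borel_measurable borel"
    using \<theta> by (rule borel_measurable_continuous_onI)
  have "{\<omega> \<in> space M. \<bar>q - \<theta> (\<omega> q)\<bar> < inverse (real (Suc n))} \<in> sets M"
    if "q \<in> D" for q n
  proof -
    have [measurable]: "(\<lambda>\<omega>. \<theta> (\<omega> q)) \<in> borel_measurable M"
      using measurable_compose[OF X_measurable \<theta>_borel] that D(2) by blast
    show ?thesis by measurable
  qed
  then have "{\<omega> \<in> space M. \<forall>n. \<exists>q\<in>D. \<bar>q - \<theta> (\<omega> q)\<bar> < inverse (real (Suc n))} \<in> sets M"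
    using D(1) by (intro sets.sets_Collect_countable_All sets.sets_Collect_countable_Ex') auto
  also have "{\<omega> \<in> space M. \<forall>n. \<exists>q\<in>D. \<bar>q - \<theta> (\<omega> q)\<bar> < inverse (real (Suc n))}
      = {\<omega> \<in> space M. \<exists>s\<in>{t..T}. s = \<theta> (\<omega> s)}"
    using hits by blast
  finally show ?thesis .
qed

section \<open>The hitting rule and its full scenario\<close>

text \<open>The set of hitting times is closed, being the zero set of a continuous function on a
  closed interval. It is also nonempty and bounded below, so its infimum is itself a hitting
  time.\<close>

lemma hitting_rule_hits:
  fixes \<theta> :: "'e::topological_space \<Rightarrow> real"
  assumes "\<omega> \<in> space M" and path: "continuous_on {t..T} \<omega>"
    and \<theta>: "continuous_on UNIV \<theta>" and hit: "\<exists>s\<in>{t..T}. s = \<theta> (\<omega> s)"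
  shows "hitting_rule M T \<theta> t \<omega> = \<theta> (\<omega> (hitting_rule M T \<theta> t \<omega>))"
proof -
  let ?S = "{s \<in> {t..T}. s = \<theta> (\<omega> s)}"
  have "continuous_on {t..T} (\<lambda>s. s - \<theta> (\<omega> s))"
    by (intro continuous_intros continuous_on_compose2[OF \<theta> path]) auto
  then have "closed ({t..T} \<inter> (\<lambda>s. s - \<theta> (\<omega> s)) -` {0})"
    by (intro continuous_closed_preimage) auto
  also have "{t..T} \<inter> (\<lambda>s. s - \<theta> (\<omega> s)) -` {0} = ?S"
    by auto
  finally have "Inf ?S \<in> ?S"
    using hit by (intro closed_contains_Inf) (auto intro!: bdd_belowI[of _ t])
  moreover have "hitting_rule M T \<theta> t \<omega> = Inf ?S"
    using assms(1) hit by (auto simp: hitting_rule_def Let_def)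
  ultimately show ?thesis by simp
qed

lemma path_hits_graph:
  fixes \<theta> :: "'e::topological_space \<Rightarrow> real"
  assumes "continuous_on {t..T} \<omega>" "continuous_on UNIV \<theta>" "t \<le> T"
    and "t \<le> \<theta> (\<omega> t)" "\<theta> (\<omega> T) \<le> T"
  shows "\<exists>s\<in>{t..T}. s = \<theta> (\<omega> s)"
proof -
  have "continuous_on {t..T} (\<lambda>s. s - \<theta> (\<omega> s))"
    by (intro continuous_intros continuous_on_compose2[OF assms(2,1)]) auto
  then have "\<exists>s\<ge>t. s \<le> T \<and> s - \<theta> (\<omega> s) = 0"
    using assms(3-5) by (intro IVT') auto
  then show ?thesis by auto
qed

text \<open>\<open>P s y\<close> stands for membership of \<open>s\<close> in
  \<open>argmin_times\<close> or \<open>argmax_times\<close> at \<open>y\<close>, so one proof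
  serves both halves of the theorem. Closedness is asked only of the slice at \<open>T\<close>: a
  path that misses the graph receives the default value \<open>T\<close>, and on such paths the
  event reduces to a condition on the terminal position.\<close>

lemma full_scenario_hitting_rule:
  fixes M :: "(real \<Rightarrow> 'e::polish_space) measure"
  assumes X_measurable: "\<And>s. s \<in> {t..T} \<Longrightarrow> (\<lambda>\<omega>. \<omega> s) \<in> M \<rightarrow>\<^sub>M borel"
    and paths: "\<And>\<omega>. \<omega> \<in> space M \<Longrightarrow> continuous_on {t..T} \<omega>"
    and \<theta>: "continuous_on UNIV \<theta>" "\<And>y. \<theta> y \<le> T" "\<And>y. P (\<theta> y) y"
    and closed: "closed {y. P T y}"
    and "t \<le> \<theta> x"
    and start: "full_scenario M H \<E> {\<omega> \<in> space M. \<omega> t = x}"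
    and H_mult: "\<And>Y Z. Y \<in> H \<Longrightarrow> Z \<in> Linf M \<Longrightarrow> (\<lambda>\<omega>\<in>space M. Y \<omega> * Z \<omega>) \<in> H"
  defines "\<tau> \<equiv> hitting_rule M T \<theta> t"
  shows "full_scenario M H \<E> {\<omega> \<in> space M. P (\<tau> \<omega>) (\<omega> (\<tau> \<omega>))}"
proof -
  have "t \<le> T" using \<open>t \<le> \<theta> x\<close> \<theta>(2)[of x] by simp
  let ?hit = "\<lambda>\<omega>. \<exists>s\<in>{t..T}. s = \<theta> (\<omega> s)"
  let ?A = "{\<omega> \<in> space M. P (\<tau> \<omega>) (\<omega> (\<tau> \<omega>))}"
  have hit: "P (\<tau> \<omega>) (\<omega> (\<tau> \<omega>))" if "\<omega> \<in> space M" "?hit \<omega>" for \<omega>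
    using hitting_rule_hits[OF that(1) paths[OF that(1)] \<theta>(1) that(2)] \<theta>(3) unfolding \<tau>_def by metis
  have miss: "\<tau> \<omega> = T" if "\<omega> \<in> space M" "\<not> ?hit \<omega>" for \<omega>
    using that by (auto simp: \<tau>_def hitting_rule_def Let_def)
  show ?thesis
  proof (rule full_scenario_superset[OF start _ _ H_mult])
    show "{\<omega> \<in> space M. \<omega> t = x} \<subseteq> ?A"
      using hit path_hits_graph[OF paths \<theta>(1) \<open>t \<le> T\<close>] \<open>t \<le> \<theta> x\<close> \<theta>(2) by blast
    \<comment> \<open>Avoids the measurability of \<open>\<tau>\<close> and \<open>X\<^sub>\<tau>\<close>, which is not available when \<open>\<tau>\<close> is not admissible.\<close>
    have "?A = {\<omega> \<in> space M. ?hit \<omega>}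
        \<union> ({\<omega> \<in> space M. \<omega> T \<in> {y. P T y}} - {\<omega> \<in> space M. ?hit \<omega>})"
      (is "_ = ?R")
    proof (rule set_eqI)
      fix \<omega> show "\<omega> \<in> ?A \<longleftrightarrow> \<omega> \<in> ?R"
        using hit[of \<omega>] miss[of \<omega>] by (cases "?hit \<omega>") auto
    qed
    moreover have "{\<omega> \<in> space M. \<omega> T \<in> {y. P T y}} \<in> sets M"
    proof -
      have "(\<lambda>\<omega>. \<omega> T) -` {y. P T y} \<inter> space M \<in> sets M"
        using \<open>t \<le> T\<close> closed by (intro measurable_sets[OF X_measurable]) auto
      then show ?thesis by (simp add: vimage_def Int_def conj_commute)
    qed
    moreover have "{\<omega> \<in> space M. ?hit \<omega>} \<in> sets M"
      using X_measurable paths \<theta>(1) \<open>t \<le> T\<close> by (rule sets_hits_graph)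
    ultimately show "?A \<in> sets M" by auto
  qed
qed

section \<open>Payoffs\<close>

text \<open>\<open>1/B\<close> is continuous on the compact \<open>{0..T}\<close>, so the discount
  factor at \<open>\<tau>\<close> is bounded and measurable; \<open>H_mult\<close> then absorbs it
  and \<open>H_add\<close> joins the two terms.\<close>

lemma payoff_mem:
  assumes \<tau>: "\<tau> \<in> L0 M" "\<forall>\<omega>\<in>space M. \<tau> \<omega> \<in> {0..T}"
    and B_pos: "\<And>s. s \<in> {0..T} \<Longrightarrow> 0 < B s" and B_continuous: "continuous_on {0..T} B"
    and \<rho>: "(\<lambda>\<omega>\<in>space M. \<rho> t (\<tau> \<omega>) \<omega> (restrict B {0..T})) \<in> H"
    and F: "(\<lambda>\<omega>\<in>space M. F (\<tau> \<omega>) (\<omega> (\<tau> \<omega>))) \<in> H"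
    and H_add: "\<And>Y Z. Y \<in> H \<Longrightarrow> Z \<in> H \<Longrightarrow> (\<lambda>\<omega>\<in>space M. Y \<omega> + Z \<omega>) \<in> H"
    and H_mult: "\<And>Y Z. Y \<in> H \<Longrightarrow> Z \<in> Linf M \<Longrightarrow> (\<lambda>\<omega>\<in>space M. Y \<omega> * Z \<omega>) \<in> H"
  shows "payoff M T B \<rho> F t \<tau> \<in> H"
proof -
  let ?Z = "\<lambda>\<omega>\<in>space M. inverse (B (\<tau> \<omega>))"
  have cont: "continuous_on {0..T} (\<lambda>s. inverse (B s))"
    using B_continuous B_pos by (intro continuous_intros) force+
  have "(\<lambda>\<omega>. inverse (B (\<tau> \<omega>))) \<in> borel_measurable M"
  \<comment> \<open>The intermediate space is restricted to \<open>{0..T}\<close>, the set on which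
    \<open>B\<close> is known to be continuous.\<close>
  proof (rule measurable_compose[where f = \<tau> and g = "\<lambda>s. inverse (B s)"])
    show "\<tau> \<in> M \<rightarrow>\<^sub>M restrict_space borel {0..T}"
      using \<tau> unfolding L0_def by (intro measurable_restrict_space2) auto
    show "(\<lambda>s. inverse (B s)) \<in> borel_measurable (restrict_space borel {0..T})"
      using cont by (rule borel_measurable_continuous_on_restrict)
  qed
  moreover have "bounded (?Z ` space M)"
  proof (rule bounded_subset)
    show "bounded ((\<lambda>s. inverse (B s)) ` {0..T})"
      using cont by (intro compact_imp_bounded compact_continuous_image) auto
    show "?Z ` space M \<subseteq> (\<lambda>s. inverse (B s)) ` {0..T}"
      using \<tau>(2) by auto
  qed
  ultimately have "?Z \<in> Linf M"
    unfolding Linf_def L0_def by (simp cong: measurable_cong)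
  note H_add[OF \<rho> H_mult[OF F this]]
  also have "(\<lambda>\<omega>\<in>space M. (\<lambda>\<omega>\<in>space M. \<rho> t (\<tau> \<omega>) \<omega> (restrict B {0..T})) \<omega>
      + (\<lambda>\<omega>\<in>space M. (\<lambda>\<omega>\<in>space M. F (\<tau> \<omega>) (\<omega> (\<tau> \<omega>))) \<omega> * ?Z \<omega>) \<omega>)
      = payoff M T B \<rho> F t \<tau>"
    unfolding payoff_def by (auto simp: fun_eq_iff mult.commute)
  finally show ?thesis .
qed

lemma payoff_mono:
  assumes "0 < B (\<tau> \<omega>)" "\<omega> \<in> space M" "F (\<tau> \<omega>) (\<omega> (\<tau> \<omega>)) \<le> G (\<tau> \<omega>) (\<omega> (\<tau> \<omega>))"
  shows "payoff M T B \<rho> F t \<tau> \<omega> \<le> payoff M T B \<rho> G t \<tau> \<omega>"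
  using assms unfolding payoff_def by (auto intro: mult_left_mono)

section \<open>Extremal times of the value function\<close>

text \<open>At a fixed time the condition is an intersection, over all competing times
  \<open>s\<close>, of closed sets \<open>{y. v t y \<le> v s y}\<close>. Taken at \<open>T\<close>,
  this is the closedness that \<open>full_scenario_hitting_rule\<close> asks for.\<close>

lemma closed_argmin_times:
  fixes v :: "real \<Rightarrow> 'e::topological_space \<Rightarrow> real"
  assumes v: "\<And>s. s \<in> {0..T} \<Longrightarrow> continuous_on UNIV (v s)" and t: "t \<in> {0..T}"
  shows "closed {y. t \<in> argmin_times T v y}"
proof -
  have "{y. t \<in> argmin_times T v y} = (\<Inter>s\<in>{0..T}. {y. v t y \<le> v s y})"
    using t by (auto simp: argmin_times_def is_arg_min_linorder)
  then show ?thesis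
    using v t by (auto intro!: closed_INT closed_Collect_le)
qed

lemma argmax_times_eq_argmin_times:
  "argmax_times T v y = argmin_times T (\<lambda>s y. - v s y) y"
  by (auto simp: argmax_times_def argmin_times_def is_arg_max_def is_arg_min_def)

lemma argmin_times_INF:
  assumes "t \<in> argmin_times T v y"
  shows "(INF s\<in>{0..T}. v s y :: real) = v t y"
  using assms by (intro cInf_eq_minimum) (auto simp: argmin_times_def is_arg_min_linorder)

lemma argmax_times_SUP:
  assumes "t \<in> argmax_times T v y"
  shows "(SUP s\<in>{0..T}. v s y :: real) = v t y"
  using assms by (intro cSup_eq_maximum) (auto simp: argmax_times_def is_arg_max_linorder)

section \<open>Optimality of the hitting rule\<close>

theorem corollary2p10:
  fixes M :: "(real \<Rightarrow> 'e::polish_space) measure"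
    and T :: real
    and B :: "real \<Rightarrow> real"
    and \<T> :: "real \<Rightarrow> ((real \<Rightarrow> 'e) \<Rightarrow> real) set"
    and H :: "((real \<Rightarrow> 'e) \<Rightarrow> real) set"
    and \<E> :: "real \<Rightarrow> 'e \<Rightarrow> ((real \<Rightarrow> 'e) \<Rightarrow> real) \<Rightarrow> real"
    and \<rho> :: "real \<Rightarrow> real \<Rightarrow> (real \<Rightarrow> 'e) \<Rightarrow> (real \<Rightarrow> real) \<Rightarrow> real"
    and g f h :: "'e \<Rightarrow> real"
    and v u w :: "real \<Rightarrow> 'e \<Rightarrow> real"
  assumes paths: "space M \<subseteq> extensional {0..}"
    and X_measurable: "\<And>t. 0 \<le> t \<Longrightarrow> (\<lambda>\<omega>. \<omega> t) \<in> M \<rightarrow>\<^sub>M borel"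
    and T_pos: "0 < T"
    and B_pos: "\<And>t. 0 \<le> t \<Longrightarrow> 0 < B t"
    and B_bounded: "\<And>S. S \<subseteq> {0..} \<Longrightarrow> bounded S \<Longrightarrow>
          bounded (B ` S) \<and> bounded ((\<lambda>s. 1 / B s) ` S)"
    and B_continuous: "continuous_on {0..T} B"
    and rules: "\<And>t \<tau>. t \<in> {0..T} \<Longrightarrow> \<tau> \<in> \<T> t \<Longrightarrow>
          \<tau> \<in> L0 M \<and> (\<forall>\<omega>\<in>space M. \<tau> \<omega> \<in> {t..T})"
    and rules_mono: "\<And>s t. 0 \<le> s \<Longrightarrow> s \<le> t \<Longrightarrow> t \<le> T \<Longrightarrow> \<T> t \<subseteq> \<T> s"
    and X_rule_measurable: "\<And>\<tau>. \<tau> \<in> \<T> 0 \<Longrightarrow> (\<lambda>\<omega>. \<omega> (\<tau> \<omega>)) \<in> M \<rightarrow>\<^sub>M borel"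
    and H_L0: "H \<subseteq> L0 M"
    and H_one: "(\<lambda>\<omega>\<in>space M. 1) \<in> H"
    and H_add: "\<And>Y Z. Y \<in> H \<Longrightarrow> Z \<in> H \<Longrightarrow> (\<lambda>\<omega>\<in>space M. Y \<omega> + Z \<omega>) \<in> H"
    and H_scale: "\<And>c Y. Y \<in> H \<Longrightarrow> (\<lambda>\<omega>\<in>space M. c * Y \<omega>) \<in> H"
    and H_mult: "\<And>Y Z. Y \<in> H \<Longrightarrow> Z \<in> Linf M \<Longrightarrow> (\<lambda>\<omega>\<in>space M. Y \<omega> * Z \<omega>) \<in> H"
    and \<rho>_measurable: "(\<lambda>(t, s, \<omega>, b). \<rho> t s \<omega> b) \<in> borel_measurable (reward_space T M)"
    and g_measurable: "g \<in> borel_measurable borel"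
    and g_H: "(\<lambda>\<omega>\<in>space M. g (\<omega> T)) \<in> H"
    and \<rho>_H: "\<And>t \<tau>. t \<in> {0..T} \<Longrightarrow> \<tau> \<in> \<T> t \<or> \<tau> = (\<lambda>\<omega>\<in>space M. T) \<Longrightarrow>
          (\<lambda>\<omega>\<in>space M. \<rho> t (\<tau> \<omega>) \<omega> (restrict B {0..T})) \<in> H"
    and v_def: "\<And>t x. v t x = B t * \<E> t x (payoff M T B \<rho> (\<lambda>_. g) t (\<lambda>\<omega>\<in>space M. T))"
    and f_def: "\<And>x. f x = (INF t\<in>{0..T}. v t x)"
    and h_def: "\<And>x. h x = (SUP t\<in>{0..T}. v t x)"
    and u_def: "\<And>t x. u t x = (SUP \<tau>\<in>\<T> t. B t * \<E> t x (payoff M T B \<rho> (\<lambda>_. f) t \<tau>))"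
    and w_def: "\<And>t x. w t x = (INF \<tau>\<in>\<T> t. B t * \<E> t x (payoff M T B \<rho> (\<lambda>_. h) t \<tau>))"
    and E_I: "\<And>t x c. t \<in> {0..T} \<Longrightarrow> \<E> t x (\<lambda>\<omega>\<in>space M. c) = c"
    and E_II: "\<And>t x Y Z. t \<in> {0..T} \<Longrightarrow> Y \<in> H \<Longrightarrow> Z \<in> H \<Longrightarrow>
          (\<forall>\<omega>\<in>space M. Y \<omega> \<le> Z \<omega>) \<Longrightarrow> \<E> t x Y \<le> \<E> t x Z"
    and E_III: "\<And>t x Y Z. t \<in> {0..T} \<Longrightarrow> Y \<in> H \<Longrightarrow> Z \<in> H \<Longrightarrow>
          (\<forall>\<omega>\<in>space M. Y \<omega> \<le> Z \<omega>) \<Longrightarrow> \<E> t x Y = \<E> t x Z \<Longrightarrow>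
          full_scenario M H (\<E> t x) {\<omega> \<in> space M. Y \<omega> = Z \<omega>}"
    and E_IV: "\<And>t x. t \<in> {0..T} \<Longrightarrow> full_scenario M H (\<E> t x) {\<omega> \<in> space M. \<omega> t = x}"
    and E_V: "\<And>\<tau>. \<tau> \<in> \<T> 0 \<Longrightarrow>
          (\<lambda>\<omega>\<in>space M. v (\<tau> \<omega>) (\<omega> (\<tau> \<omega>))) \<in> H \<and>
          (\<lambda>\<omega>\<in>space M. INF s\<in>{0..T}. v s (\<omega> (\<tau> \<omega>))) \<in> H \<and>
          (\<lambda>\<omega>\<in>space M. SUP s\<in>{0..T}. v s (\<omega> (\<tau> \<omega>))) \<in> H"
    and E_VI: "\<And>t x \<tau>. t \<in> {0..T} \<Longrightarrow> \<tau> \<in> \<T> t \<Longrightarrow>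
          v t x = B t * \<E> t x (payoff M T B \<rho> v t \<tau>)"
    and continuous_paths: "\<And>\<omega>. \<omega> \<in> space M \<Longrightarrow> continuous_on {0..} \<omega>"
    and v_continuous: "continuous_on ({0..T} \<times> UNIV) (\<lambda>(t, x). v t x)"
  shows "(\<forall>\<theta> t x.
            continuous_on UNIV \<theta> \<longrightarrow> (\<forall>y. \<theta> y \<in> {0..T}) \<longrightarrow> (\<forall>y. \<theta> y \<in> argmin_times T v y) \<longrightarrow>
            t \<in> {0..T} \<longrightarrow> t \<le> \<theta> x \<longrightarrow>
            (let \<tau> = hitting_rule M T \<theta> t in
               full_scenario M H (\<E> t x) {\<omega> \<in> space M. \<tau> \<omega> \<in> argmin_times T v (\<omega> (\<tau> \<omega>))} \<and>
               (\<tau> \<in> \<T> t \<longrightarrow>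
                  u t x = B t * \<E> t x (payoff M T B \<rho> (\<lambda>_. f) t \<tau>) \<and>
                  B t * \<E> t x (payoff M T B \<rho> (\<lambda>_. f) t \<tau>) = v t x))) \<and>
         (\<forall>\<theta> t x.
            continuous_on UNIV \<theta> \<longrightarrow> (\<forall>y. \<theta> y \<in> {0..T}) \<longrightarrow> (\<forall>y. \<theta> y \<in> argmax_times T v y) \<longrightarrow>
            t \<in> {0..T} \<longrightarrow> t \<le> \<theta> x \<longrightarrow>
            (let \<tau> = hitting_rule M T \<theta> t in
               full_scenario M H (\<E> t x) {\<omega> \<in> space M. \<tau> \<omega> \<in> argmax_times T v (\<omega> (\<tau> \<omega>))} \<and>
               (\<tau> \<in> \<T> t \<longrightarrow>
                  w t x = B t * \<E> t x (payoff M T B \<rho> (\<lambda>_. h) t \<tau>) \<and>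
                  B t * \<E> t x (payoff M T B \<rho> (\<lambda>_. h) t \<tau>) = v t x)))"
proof -
  \<comment> \<open>Joint continuity is used in two slices: continuity in time bounds
    \<open>v\<close> along \<open>{0..T}\<close>, continuity in space makes the sets of extremal
    positions closed.\<close>
  have v_time: "continuous_on {0..T} (\<lambda>s. v s y)" for y
  proof -
    have "continuous_on {0..T} (\<lambda>s. (s, y))"
      by (intro continuous_intros)
    from continuous_on_compose2[OF v_continuous this] show ?thesis by auto
  qed
  have v_space: "continuous_on UNIV (v s)" if "s \<in> {0..T}" for s
  proof -
    have "continuous_on UNIV (\<lambda>y :: 'e. (s, y))"
      by (intro continuous_intros)
    from continuous_on_compose2[OF v_continuous this] show ?thesis
      using that by (simp add: image_subset_iff)
  qed
  \<comment> \<open>A real \<open>INF\<close> or \<open>SUP\<close> is a genuine bound only over a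
    bounded set, so this precedes the comparison of \<open>f\<close> and \<open>h\<close> with
    \<open>v\<close>.\<close>
  have v_bounded: "bounded ((\<lambda>s. v s y) ` {0..T})" for y
    by (intro compact_imp_bounded compact_continuous_image v_time) auto
  have f_le: "f y \<le> v s y" and le_h: "v s y \<le> h y" if "s \<in> {0..T}" for s y
    using that v_bounded[of y] unfolding f_def h_def
    by (auto intro!: cINF_lower cSUP_upper bounded_imp_bdd_below bounded_imp_bdd_above)
  \<comment> \<open>\<open>E_V\<close> speaks of rules in \<open>\<T> 0\<close>; monotonicity of the
    classes brings every \<open>\<T> t\<close> under it.\<close>
  have rule0: "\<sigma> \<in> \<T> 0" "\<sigma> \<in> L0 M" "\<forall>\<omega>\<in>space M. \<sigma> \<omega> \<in> {0..T}"
    if "\<sigma> \<in> \<T> t" "t \<in> {0..T}" for \<sigma> t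
    using that rules[of t \<sigma>] rules_mono[of 0 t] by force+
  \<comment> \<open>The three choices of \<open>F\<close> are exactly the three memberships supplied
    by \<open>E_V\<close>.\<close>
  have mem: "payoff M T B \<rho> F t \<sigma> \<in> H"
    if "\<sigma> \<in> \<T> t" "t \<in> {0..T}" "F \<in> {v, \<lambda>_. f, \<lambda>_. h}" for F \<sigma> t
  proof (rule payoff_mem[OF rule0(2,3)[OF that(1,2)] _ B_continuous _ _ H_add H_mult])
    show "(\<lambda>\<omega>\<in>space M. \<rho> t (\<sigma> \<omega>) \<omega> (restrict B {0..T})) \<in> H"
      using \<rho>_H that by blast
    show "(\<lambda>\<omega>\<in>space M. F (\<sigma> \<omega>) (\<omega> (\<sigma> \<omega>))) \<in> H"
      using E_V[OF rule0(1)[OF that(1,2)]] that(3) by (auto simp: f_def h_def)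
  qed (auto intro: B_pos)
  \<comment> \<open>Dynamic programming with the same \<open>\<sigma>\<close> rewrites
    \<open>v t x\<close> as the value of the payoff built from \<open>v\<close>; then
    \<open>f \<le> v \<le> h\<close> along \<open>\<sigma>\<close> and monotonicity
    \<open>E_II\<close> give both bounds.\<close>
  have f_value_le: "B t * \<E> t x (payoff M T B \<rho> (\<lambda>_. f) t \<sigma>) \<le> v t x"
    and h_value_ge: "v t x \<le> B t * \<E> t x (payoff M T B \<rho> (\<lambda>_. h) t \<sigma>)"
    if \<sigma>: "\<sigma> \<in> \<T> t" "t \<in> {0..T}" for \<sigma> t x
    unfolding E_VI[OF that(2,1)] using that(2) rule0(3)[OF \<sigma>]
    by (auto intro!: mult_left_mono less_imp_le[OF B_pos] E_II mem[OF \<sigma>] payoff_mono B_pos f_le le_h)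
  \<comment> \<open>Agreement of \<open>F\<close> with \<open>v\<close> at the stopped position on a
    full scenario suffices to replace \<open>F\<close> by \<open>v\<close> inside the functional,
    after which \<open>E_VI\<close> evaluates it.\<close>
  have value_eq: "B t * \<E> t x (payoff M T B \<rho> F t \<sigma>) = v t x"
    if "\<sigma> \<in> \<T> t" "t \<in> {0..T}" "F \<in> {v, \<lambda>_. f, \<lambda>_. h}" "full_scenario M H (\<E> t x) A"
      "\<And>\<omega>. \<omega> \<in> A \<Longrightarrow> F (\<sigma> \<omega>) (\<omega> (\<sigma> \<omega>)) = v (\<sigma> \<omega>) (\<omega> (\<sigma> \<omega>))" for F \<sigma> t x A
  proof -
    have "\<E> t x (payoff M T B \<rho> F t \<sigma>) = \<E> t x (payoff M T B \<rho> v t \<sigma>)"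
      using that(5) mem[OF that(1,2)] that(3)
      by (intro full_scenario_cong[OF that(4)]) (auto simp: payoff_def)
    then show ?thesis
      using E_VI[OF that(2,1)] by simp
  qed
  have full: "full_scenario M H (\<E> t x)
      {\<omega> \<in> space M. P (hitting_rule M T \<theta> t \<omega>) (\<omega> (hitting_rule M T \<theta> t \<omega>))}"
    if "continuous_on UNIV \<theta>" "\<forall>y. \<theta> y \<in> {0..T}" "\<forall>y. P (\<theta> y) y" "closed {y. P T y}"
      "t \<in> {0..T}" "t \<le> \<theta> x" for P \<theta> t x
    using that
    by (intro full_scenario_hitting_rule[where x = x] X_measurable E_IV H_mult
        continuous_on_subset[OF continuous_paths]) auto
  have closed_min: "closed {y. T \<in> argmin_times T v y}"
    using T_pos by (intro closed_argmin_times v_space) auto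
  have closed_max: "closed {y. T \<in> argmax_times T v y}"
    unfolding argmax_times_eq_argmin_times
    using T_pos by (intro closed_argmin_times continuous_on_minus v_space) auto
  show ?thesis
    unfolding Let_def
  proof (intro conjI allI impI)
    fix \<theta> t x
    let ?\<tau> = "hitting_rule M T \<theta> t"
    assume \<theta>: "continuous_on UNIV \<theta>" "\<forall>y. \<theta> y \<in> {0..T}" "\<forall>y. \<theta> y \<in> argmin_times T v y"
      and t: "t \<in> {0..T}" "t \<le> \<theta> x"
    show full_min: "full_scenario M H (\<E> t x)
        {\<omega> \<in> space M. ?\<tau> \<omega> \<in> argmin_times T v (\<omega> (?\<tau> \<omega>))}"
      by (rule full[OF \<theta> closed_min t])
    assume \<tau>: "?\<tau> \<in> \<T> t"
    show eq: "B t * \<E> t x (payoff M T B \<rho> (\<lambda>_. f) t ?\<tau>) = v t x"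
      by (rule value_eq[OF \<tau> t(1) _ full_min]) (auto simp: f_def argmin_times_INF)
    \<comment> \<open>The supremum is a maximum: \<open>f_value_le\<close> caps every rule at
      \<open>v t x\<close>, and by \<open>eq\<close> the hitting rule reaches the cap.\<close>
    show "u t x = B t * \<E> t x (payoff M T B \<rho> (\<lambda>_. f) t ?\<tau>)"
      unfolding u_def using f_value_le[OF _ t(1)] by (intro cSup_eq_maximum rev_image_eqI[OF \<tau>]) (auto simp: eq)
  next
    fix \<theta> t x
    let ?\<tau> = "hitting_rule M T \<theta> t"
    assume \<theta>: "continuous_on UNIV \<theta>" "\<forall>y. \<theta> y \<in> {0..T}" "\<forall>y. \<theta> y \<in> argmax_times T v y"
      and t: "t \<in> {0..T}" "t \<le> \<theta> x"
    show full_max: "full_scenario M H (\<E> t x)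
        {\<omega> \<in> space M. ?\<tau> \<omega> \<in> argmax_times T v (\<omega> (?\<tau> \<omega>))}"
      by (rule full[OF \<theta> closed_max t])
    assume \<tau>: "?\<tau> \<in> \<T> t"
    show eq: "B t * \<E> t x (payoff M T B \<rho> (\<lambda>_. h) t ?\<tau>) = v t x"
      by (rule value_eq[OF \<tau> t(1) _ full_max]) (auto simp: h_def argmax_times_SUP)
    \<comment> \<open>Dually, \<open>h_value_ge\<close> makes \<open>v t x\<close> a lower bound
      over all rules, attained by the hitting rule.\<close>
    show "w t x = B t * \<E> t x (payoff M T B \<rho> (\<lambda>_. h) t ?\<tau>)"
      unfolding w_def using h_value_ge[OF _ t(1)] by (intro cInf_eq_minimum rev_image_eqI[OF \<tau>]) (auto simp: eq)
  qed
qed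

end
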